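(* Let $\Psi=(\psi_1,\dots,\psi_{16}):\mathbb{Z}^8\to\mathbb{Z}^{16}$ be the system of linear forms in $x=(x_1,\dots,x_8)$ given by $\psi_i(x)=x_i$ for $1\le i\le 7$, and $$\begin{aligned} \psi_8&=x_1+x_2+x_3+x_4-x_5-x_6-x_7, & \psi_9&=x_8,\\ \psi_{10}&=x_1-x_4+x_5-x_7+x_8, & \psi_{11}&=x_2+x_3+2x_4-x_5-x_6-x_8,\\ \psi_{12}&=x_6+x_7-x_8, & \psi_{13}&=x_2+x_3+x_4-x_5-x_8,\\ \psi_{14}&=x_3+2x_4-x_5-x_6+x_7-x_8, & \psi_{15}&=x_1-x_3-x_4+x_5+x_6-x_7+x_8,\\ \psi_{16}&=-x_4+x_5+x_8, && \end{aligned}$$ which parametrizes the $4\times4$ $\mathbb{Z}$-magic squares. The complexity of $\Psi$ is $1$.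
   Context: A $4\times 4$ $\mathbb{Z}$-magic square is a $4\times 4$ array of integers such that the sum of the entries in every row, every column and each of the two main diagonals is the same; its entries are listed from left to right and from top to bottom. Complexity: let $\Psi=(\psi_1,\dots,\psi_t)$ be a system of linear forms. For an integer $s\ge0$, $\Psi$ has $i$-complexity at most $s$ if one can write the set of $t-1$ forms $\{\psi_1,\dots,\psi_{i-1},\psi_{i+1},\dots,\psi_t\}$ as a union of $s+1$ sets in such a way that $\psi_i$ does not lie in the linear span over $\mathbb{Q}$ of any of these sets (for affine-linear forms one uses the affine-linear span over $\mathbb{Q}$). The complexity of $\Psi$ is the least $s$ for which the system has $i$-complexity at most $s$ for all $1\le i\le t$, or $\infty$ if no such $s$ exists. *)

theory Defs
  imports "HOL-Analysis.Finite_Cartesian_Product" "HOL-Library.Numeral_Type"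
    "HOL-Library.Function_Algebras" "HOL-Library.Extended_Nat"
begin

interpretation rat_fun: vector_space "\<lambda>(c::rat) (f :: 'a \<Rightarrow> rat) x. c * f x"
  by unfold_locales (auto simp: algebra_simps plus_fun_def)

definition rat_span :: "(int ^ 'n \<Rightarrow> int) set \<Rightarrow> (int ^ 'n \<Rightarrow> rat) set" where
  "rat_span F = rat_fun.span ((\<lambda>\<phi> x. rat_of_int (\<phi> x)) ` F)"

text \<open>
  A system of \<open>t\<close> linear forms on \<open>\<int>\<^sup>n\<close> is given by its components \<open>\<psi> 1, \<dots>, \<psi> t\<close>;
  values of \<open>\<psi>\<close> outside \<open>{1..t}\<close> are irrelevant.
  The \<open>s + 1\<close> sets are \<open>A 0, \<dots>, A s\<close>; some of them may be empty or overlap.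
\<close>

definition i_complexity_le :: "nat \<Rightarrow> (nat \<Rightarrow> int ^ 'n \<Rightarrow> int) \<Rightarrow> nat \<Rightarrow> nat \<Rightarrow> bool" where
  "i_complexity_le t \<psi> i s \<longleftrightarrow>
     (\<exists>A :: nat \<Rightarrow> (int ^ 'n \<Rightarrow> int) set.
        \<psi> ` ({1..t} - {i}) = (\<Union>k\<le>s. A k) \<and>
        (\<forall>k\<le>s. (\<lambda>x. rat_of_int (\<psi> i x)) \<notin> rat_span (A k)))"

text \<open>The infimum of the empty set in \<^typ>\<open>enat\<close> is \<open>\<infinity>\<close>.\<close>

definition complexity :: "nat \<Rightarrow> (nat \<Rightarrow> int ^ 'n \<Rightarrow> int) \<Rightarrow> enat" where
  "complexity t \<psi> = Inf {enat s |s. \<forall>i\<in>{1..t}. i_complexity_le t \<psi> i s}"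

text \<open>The entry in row \<open>r\<close> and column \<open>c\<close> is \<open>M r c\<close>, for \<open>1 \<le> r, c \<le> 4\<close>.\<close>

definition magic_square :: "(nat \<Rightarrow> nat \<Rightarrow> int) \<Rightarrow> bool" where
  "magic_square M \<longleftrightarrow>
     (\<exists>S. (\<forall>r\<in>{1..4}. (\<Sum>c=1..4. M r c) = S) \<and>
          (\<forall>c\<in>{1..4}. (\<Sum>r=1..4. M r c) = S) \<and>
          (\<Sum>r=1..4. M r r) = S \<and>
          (\<Sum>r=1..4. M r (5 - r)) = S)"

end

theory Submission
  imports Defs
begin

text \<open>
  The values of the system are exactly the \<open>4 \<times> 4\<close> magic squares, and this alone determines the
  complexity.

  It is not \<open>0\<close>, because the entries satisfy a nontrivial linear relation: comparing the first row
  with the last one expresses the sixteenth entry through seven others.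

  It is at most \<open>1\<close>, because there is a pair of orthogonal diagonal Latin squares of order 4. In a
  diagonal Latin square each symbol occurs once in every row, column and main diagonal, so the
  indicator of a symbol is a magic square. Given a cell \<open>i\<close>, take for each of the two Latin
  squares the indicator of the symbol that it has in \<open>i\<close>. These two magic squares are nonzero at
  \<open>i\<close>, and by orthogonality no other cell lies in both supports. Hence every form other than
  \<open>\<psi> i\<close> vanishes at one of the two corresponding points, while \<open>\<psi> i\<close> vanishes at neither
  (\<open>i_complexity_leI\<close>, \<open>i_complexity_le_1_if_surj_magic\<close>).
\<close>

text \<open>
  The functions that vanish at \<open>u\<close> form a subspace, so a single point can serve as a certificate
  that a form lies outside a span.
\<close>

lemma notin_rat_span_if_vanishing:
  assumes "\<And>\<phi>. \<phi> \<in> A \<Longrightarrow> \<phi> u = 0" and "\<theta> u \<noteq> 0"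
  shows "(\<lambda>x. rat_of_int (\<theta> x)) \<notin> rat_span A"
proof
  assume "(\<lambda>x. rat_of_int (\<theta> x)) \<in> rat_span A"
  moreover have "rat_fun.subspace {f. f u = 0}"
    by (auto simp: rat_fun.subspace_def)
  then have "rat_span A \<subseteq> {f. f u = 0}"
    unfolding rat_span_def by (intro rat_fun.span_minimal) (auto simp: assms(1))
  ultimately show False using assms(2) by auto
qed

text \<open>
  The \<open>k\<close>-th of the \<open>s + 1\<close> sets consists of the forms that vanish at the point \<open>u k\<close>.
\<close>

lemma i_complexity_leI:
  assumes "\<And>k. k \<le> s \<Longrightarrow> \<psi> i (u k) \<noteq> 0"
    and "\<And>j. j \<in> {1..t} - {i} \<Longrightarrow> \<exists>k\<le>s. \<psi> j (u k) = 0"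
  shows "i_complexity_le t \<psi> i s"
proof -
  define A where "A k = \<psi> ` {j \<in> {1..t} - {i}. \<psi> j (u k) = 0}" for k
  have "\<psi> ` ({1..t} - {i}) = (\<Union>k\<le>s. A k)"
    unfolding A_def using assms(2) by blast
  moreover have "(\<lambda>x. rat_of_int (\<psi> i x)) \<notin> rat_span (A k)" if "k \<le> s" for k
    using assms(1)[OF that] by (rule notin_rat_span_if_vanishing[rotated]) (auto simp: A_def)
  ultimately show ?thesis
    unfolding i_complexity_le_def by blast
qed

lemma not_i_complexity_le_0I:
  assumes "\<And>x. rat_of_int (\<psi> i x) = (\<Sum>j\<in>{1..t} - {i}. c j * rat_of_int (\<psi> j x))"
  shows "\<not> i_complexity_le t \<psi> i 0"
proof -
  let ?B = "\<psi> ` ({1..t} - {i})"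
  let ?g = "\<lambda>j x. c j * rat_of_int (\<psi> j x)"
  have "sum ?g ({1..t} - {i}) \<in> rat_span ?B"
    unfolding rat_span_def
    by (intro rat_fun.span_sum rat_fun.span_scale rat_fun.span_base imageI)
  moreover have "sum ?g J = (\<lambda>x. \<Sum>j\<in>J. ?g j x)" if "finite J" for J
    using that by induction (auto simp: zero_fun_def plus_fun_def)
  ultimately have "(\<lambda>x. rat_of_int (\<psi> i x)) \<in> rat_span ?B"
    by (simp add: assms)
  then show ?thesis
    unfolding i_complexity_le_def by auto
qed

lemma atLeastAtMost_1_4: "{1..4::nat} = {1, 2, 3, 4}"
  by auto

lemma atLeastAtMost_1_16: "{1..16::nat} = {1, 2, 3, 4, 5, 6, 7, 8, 9, 10, 11, 12, 13, 14, 15, 16}"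
  by (simp add: atLeastAtMost_upt upt_conv_Cons numeral_eq_Suc)

lemmas magic_square_expand = magic_square_def atLeastAtMost_1_4

lemma cell_cases:
  fixes j :: nat
  assumes "j \<in> {1..16}"
  obtains r c where "r \<in> {1..4}" "c \<in> {1..4}" "j = 4 * (r - 1) + c"
proof
  show "(j - 1) div 4 + 1 \<in> {1..4}" "(j - 1) mod 4 + 1 \<in> {1..4}"
    using assms by auto
  show "j = 4 * ((j - 1) div 4 + 1 - 1) + ((j - 1) mod 4 + 1)"
    using assms by simp
qed

text \<open>
  The two orthogonal diagonal Latin squares, listed row by row; the leading \<open>0\<close> only shifts the
  numbering of the cells so that it starts at \<open>1\<close>.
\<close>

definition latin1 :: "nat list" where
  "latin1 = [0,  1,2,3,4,  3,4,1,2,  4,3,2,1,  2,1,4,3]"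

definition latin2 :: "nat list" where
  "latin2 = [0,  1,2,3,4,  4,3,2,1,  2,1,4,3,  3,4,1,2]"

lemma latin_symbol_magic:
  assumes "L \<in> {latin1, latin2}" and "a \<in> {1..4}"
  shows "magic_square (\<lambda>r c. of_bool (L ! (4 * (r - 1) + c) = a))"
proof -
  have "\<forall>a\<in>{1, 2, 3, 4}. magic_square (\<lambda>r c. of_bool (L ! (4 * (r - 1) + c) = a))"
    if L: "L = latin1 \<or> L = latin2"
    using L unfolding magic_square_expand
    by (elim disjE) (simp_all add: latin1_def latin2_def)
  then show ?thesis
    using assms unfolding atLeastAtMost_1_4 by blast
qed

lemma latin_symbol_range:
  assumes "L \<in> {latin1, latin2}" and "j \<in> {1..16}"
  shows "L ! j \<in> {1..4}"
proof -
  have "\<forall>j\<in>{1..16}. L ! j \<in> {1..4}" if "L = latin1 \<or> L = latin2"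
    using that unfolding atLeastAtMost_1_16
    by (elim disjE) (simp_all add: latin1_def latin2_def)
  then show ?thesis
    using assms by blast
qed

lemma latin_orthogonal:
  assumes "i \<in> {1..16}" "j \<in> {1..16}" "latin1 ! i = latin1 ! j" "latin2 ! i = latin2 ! j"
  shows "i = j"
proof -
  have "\<forall>i\<in>{1..16}. \<forall>j\<in>{1..16}. latin1 ! i = latin1 ! j \<longrightarrow> latin2 ! i = latin2 ! j \<longrightarrow> i = j"
    unfolding atLeastAtMost_1_16 by (simp add: latin1_def latin2_def)
  then show ?thesis using assms by blast
qed

lemma i_complexity_le_1_if_surj_magic:
  assumes surj: "\<And>M. magic_square M \<Longrightarrow>
      \<exists>x. \<forall>r\<in>{1..4}. \<forall>c\<in>{1..4}. M r c = \<psi> (4 * (r - 1) + c) x"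
    and i: "i \<in> {1..16}"
  shows "i_complexity_le 16 \<psi> i 1"
proof -
  have "\<exists>x. \<forall>j\<in>{1..16}. \<psi> j x = of_bool (L ! j = L ! i)" if L: "L \<in> {latin1, latin2}" for L
  proof -
    obtain x where x: "\<forall>r\<in>{1..4}. \<forall>c\<in>{1..4}.
        of_bool (L ! (4 * (r - 1) + c) = L ! i) = \<psi> (4 * (r - 1) + c) x"
      using surj[OF latin_symbol_magic[OF L latin_symbol_range[OF L i]]] by blast
    have "\<psi> j x = of_bool (L ! j = L ! i)" if "j \<in> {1..16}" for j
      using that by (rule cell_cases) (use x in auto)
    then show ?thesis by blast
  qed
  from this[of latin1] this[of latin2] obtain u v where
    u: "\<forall>j\<in>{1..16}. \<psi> j u = of_bool (latin1 ! j = latin1 ! i)" and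
    v: "\<forall>j\<in>{1..16}. \<psi> j v = of_bool (latin2 ! j = latin2 ! i)"
    by blast
  show ?thesis
  proof (rule i_complexity_leI[where u = "\<lambda>k. if k = 0 then u else v"])
    show "\<psi> i (if k = 0 then u else v) \<noteq> 0" for k :: nat
      using bspec[OF u i] bspec[OF v i] by simp
  next
    fix j assume "j \<in> {1..16} - {i}"
    then have j: "j \<in> {1..16}" "j \<noteq> i" by auto
    then have "\<psi> j u = 0 \<or> \<psi> j v = 0"
      using latin_orthogonal[OF j(1) i] bspec[OF u j(1)] bspec[OF v j(1)] by auto
    then show "\<exists>k\<le>1. \<psi> j (if k = (0::nat) then u else v) = 0"
      by (elim disjE) (rule exI[of _ 0], simp, rule exI[of _ 1], simp)
  qed
qed

text \<open>
  The first and the last row have the same sum; solve this equation for the sixteenth entry.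
\<close>

lemma not_i_complexity_le_0_if_magic:
  assumes "\<And>x. magic_square (\<lambda>r c. \<psi> (4 * (r - 1) + c) x)"
  shows "\<not> i_complexity_le 16 \<psi> 16 0"
proof (rule not_i_complexity_le_0I)
  fix x
  have "\<psi> 16 x = \<psi> 1 x + \<psi> 2 x + \<psi> 3 x + \<psi> 4 x - \<psi> 13 x - \<psi> 14 x - \<psi> 15 x"
    using assms[of x] unfolding magic_square_expand by auto
  moreover have "{1..16} - {16} = {1, 2, 3, 4, 5, 6, 7, 8, 9, 10, 11, 12, 13, 14, 15::nat}"
    unfolding atLeastAtMost_1_16 by auto
  ultimately show "rat_of_int (\<psi> 16 x) = (\<Sum>j\<in>{1..16} - {16}.
      (if j \<le> 4 then 1 else if j \<ge> 13 then - 1 else 0) * rat_of_int (\<psi> j x))"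
    by simp
qed

text \<open>
  Only the set of values of \<open>\<psi>\<close> enters: any system whose values are exactly the magic squares,
  in whatever coordinates, has the same complexity.
\<close>

theorem complexity_magic_parametrization:
  assumes "\<And>x. magic_square (\<lambda>r c. \<psi> (4 * (r - 1) + c) x)"
    and "\<And>M. magic_square M \<Longrightarrow>
      \<exists>x. \<forall>r\<in>{1..4}. \<forall>c\<in>{1..4}. M r c = \<psi> (4 * (r - 1) + c) x"
  shows "complexity 16 \<psi> = 1"
proof (rule antisym)
  show "complexity 16 \<psi> \<le> 1"
    unfolding complexity_def using i_complexity_le_1_if_surj_magic[OF assms(2)]
    by (intro Inf_lower) (auto simp: one_enat_def)
  show "1 \<le> complexity 16 \<psi>"
    unfolding complexity_def
  proof (rule Inf_greatest, clarify)
    fix s assume "\<forall>i\<in>{1..16}. i_complexity_le 16 \<psi> i s"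
    then have "i_complexity_le 16 \<psi> 16 s" by simp
    moreover have "\<not> i_complexity_le 16 \<psi> 16 0"
      using assms(1) by (rule not_i_complexity_le_0_if_magic)
    ultimately have "s \<noteq> 0" by (intro notI) simp
    then show "1 \<le> enat s" by (simp add: one_enat_def)
  qed
qed

lemma UNIV_8: "(UNIV :: 8 set) = {1, 2, 3, 4, 5, 6, 7, 8}"
proof -
  have "k \<in> {1, 2, 3, 4, 5, 6, 7, 8}" for k :: 8
  proof (cases k)
    case (of_int z)
    then have "z \<in> {0, 1, 2, 3, 4, 5, 6, 7}" by auto
    then show ?thesis using of_int by auto
  qed
  then show ?thesis by blast
qed

theorem lemma5:
  fixes \<psi> :: "nat \<Rightarrow> int ^ 8 \<Rightarrow> int"
  assumes "\<And>i x. 1 \<le> i \<Longrightarrow> i \<le> 7 \<Longrightarrow> \<psi> i x = x $ of_nat i"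
    and "\<And>x. \<psi> 8 x = x$1 + x$2 + x$3 + x$4 - x$5 - x$6 - x$7"
    and "\<And>x. \<psi> 9 x = x$8"
    and "\<And>x. \<psi> 10 x = x$1 - x$4 + x$5 - x$7 + x$8"
    and "\<And>x. \<psi> 11 x = x$2 + x$3 + 2 * x$4 - x$5 - x$6 - x$8"
    and "\<And>x. \<psi> 12 x = x$6 + x$7 - x$8"
    and "\<And>x. \<psi> 13 x = x$2 + x$3 + x$4 - x$5 - x$8"
    and "\<And>x. \<psi> 14 x = x$3 + 2 * x$4 - x$5 - x$6 + x$7 - x$8"
    and "\<And>x. \<psi> 15 x = x$1 - x$3 - x$4 + x$5 + x$6 - x$7 + x$8"
    and "\<And>x. \<psi> 16 x = - x$4 + x$5 + x$8"
  shows "(\<forall>x. magic_square (\<lambda>r c. \<psi> (4 * (r - 1) + c) x)) \<and>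
         (\<forall>M. magic_square M \<longrightarrow>
            (\<exists>!x. \<forall>r\<in>{1..4}. \<forall>c\<in>{1..4}. M r c = \<psi> (4 * (r - 1) + c) x)) \<and>
         complexity 16 \<psi> = 1"
proof -
  (* The indices 1 and 2 also occur in the successor form that simplification gives them. *)
  have low: "\<psi> 1 x = x$1" "\<psi> (Suc 0) x = x$1" "\<psi> 2 x = x$2" "\<psi> (Suc (Suc 0)) x = x$2"
    "\<psi> 3 x = x$3" "\<psi> 4 x = x$4"
    "\<psi> 5 x = x$5" "\<psi> 6 x = x$6" "\<psi> 7 x = x$7" for x
    using assms(1)[of 1 x] assms(1)[of 2 x] by (simp_all add: assms(1) numeral_2_eq_2)
  note forms = low assms(2-10)
  have magic: "magic_square (\<lambda>r c. \<psi> (4 * (r - 1) + c) x)" for x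
    unfolding magic_square_expand
    by (rule exI[of _ "x$1 + x$2 + x$3 + x$4"]) (simp add: forms)
  have param: "\<exists>!x. \<forall>r\<in>{1..4}. \<forall>c\<in>{1..4}. M r c = \<psi> (4 * (r - 1) + c) x"
    if M: "magic_square M" for M
  proof -
    (* The cells 1 to 7 and 9 carry the coordinates; the row, column and diagonal sums force the rest. *)
    define x :: "int ^ 8" where
      "x = (\<chi> k. if k = 1 then M 1 1 else if k = 2 then M 1 2 else if k = 3 then M 1 3
        else if k = 4 then M 1 4 else if k = 5 then M 2 1 else if k = 6 then M 2 2
        else if k = 7 then M 2 3 else M 3 1)"
    have x: "x$1 = M 1 1" "x$2 = M 1 2" "x$3 = M 1 3" "x$4 = M 1 4"
      "x$5 = M 2 1" "x$6 = M 2 2" "x$7 = M 2 3" "x$8 = M 3 1"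
      by (simp_all add: x_def)
    show ?thesis
    proof (rule ex1I)
      show "\<forall>r\<in>{1..4}. \<forall>c\<in>{1..4}. M r c = \<psi> (4 * (r - 1) + c) x"
        using M unfolding magic_square_expand by (simp add: forms x)
    next
      fix y assume "\<forall>r\<in>{1..4}. \<forall>c\<in>{1..4}. M r c = \<psi> (4 * (r - 1) + c) y"
      then have "\<forall>k\<in>{1, 2, 3, 4, 5, 6, 7, 8}. y $ k = x $ k"
        unfolding atLeastAtMost_1_4 by (simp add: forms x)
      then show "y = x"
        by (simp add: vec_eq_iff flip: UNIV_8)
    qed
  qed
  have "complexity 16 \<psi> = 1"
    using magic ex1_implies_ex[OF param] by (rule complexity_magic_parametrization)
  with magic param show ?thesis by blast
qed

end
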